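(* Assume $\mathfrak{d}=2^{\aleph_0}$. Let $\mathbb{B}$ be a complete c.c.c. Boolean algebra of cardinality $2^{\aleph_0}$. If $\mathbb{B}$ has a dense subalgebra of cardinality $<2^{\aleph_0}$, then there exists a non-principal ultrafilter on $\mathbb{B}$ which is not Tukey maximal.
   Context: $\mathfrak{d}$ is the dominating number. A subalgebra $\mathbb{D}\subseteq\mathbb{B}$ is dense if below every nonzero element of $\mathbb{B}$ there is a nonzero element of $\mathbb{D}$. For directed sets $\langle D,\le^D\rangle$, $\langle E,\le^E\rangle$, write $D\le_{\mathrm{T}}E$ if there are functions $f\colon D\to E$ and $g\colon E\to D$ such that for all $d\in D$, $e\in E$: $f(d)\le^E e\implies d\le^D g(e)$. An ultrafilter $U$ on a Boolean algebra $\mathbb{B}$ is regarded as the directed set $\langle U,\ge\rangle$ (reverse Boolean order), and $U$ is Tukey maximal if $\langle[\mathbb{B}]^{<\aleph_0},\subseteq\rangle\le_{\mathrm{T}}\langle U,\ge\rangle$, where $[\mathbb{B}]^{<\aleph_0}$ is the set of finite subsets of $\mathbb{B}$. *)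

theory Defs
  imports "HOL-Library.Countable_Set" "HOL-Library.FuncSet"
begin

unbundle cardinal_syntax

abbreviation continuum :: "(nat \<Rightarrow> bool) rel" where
  "continuum \<equiv> ctwo ^c natLeq"

definition dominating :: "(nat \<Rightarrow> nat) set \<Rightarrow> bool" where
  "dominating F \<longleftrightarrow> (\<forall>g. \<exists>f\<in>F. \<forall>\<^sub>F n in sequentially. g n \<le> f n)"

text \<open>Cardinals are well-orders considered up to order isomorphism \<open>=o\<close>. The dominating number is
  the cardinal of a dominating family of least cardinality; it is well defined by
  \<open>dominating_number_attained\<close> and \<open>dominating_number_least\<close> below.\<close>

definition dominating_number :: "(nat \<Rightarrow> nat) rel" where
  "dominating_number = |SOME F. dominating F \<and> (\<forall>G. dominating G \<longrightarrow> |F| \<le>o |G| )|"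

lemma ex_least_dominating: "\<exists>F. dominating F \<and> (\<forall>G. dominating G \<longrightarrow> |F| \<le>o |G| )"
proof -
  have "dominating UNIV"
    unfolding dominating_def by (meson UNIV_I always_eventually order_refl)
  then have "card_of ` Collect dominating \<noteq> {}"
    by blast
  moreover have "\<forall>r \<in> card_of ` Collect dominating. Card_order r"
    using card_of_Card_order by blast
  ultimately obtain r where "r \<in> card_of ` Collect dominating"
      "\<forall>r' \<in> card_of ` Collect dominating. r \<le>o r'"
    using exists_minim_Card_order by metis
  then show ?thesis
    by blast
qed

lemma dominating_number_attained: "\<exists>F. dominating F \<and> dominating_number = |F|"
  unfolding dominating_number_def using someI_ex[OF ex_least_dominating] by blast

lemma dominating_number_least: "dominating G \<Longrightarrow> dominating_number \<le>o |G|"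
  unfolding dominating_number_def using someI_ex[OF ex_least_dominating] by blast

text \<open>Below, a Boolean algebra is a type of class \<open>boolean_algebra\<close>; a complete one is a type of sort
  \<open>{boolean_algebra, complete_lattice}\<close>. The library class \<open>complete_boolean_algebra\<close> is not
  suitable: it extends \<open>complete_distrib_lattice\<close>, that is, it demands complete distributivity and
  so admits only atomic algebras.\<close>

definition antichain :: "'a::boolean_algebra set \<Rightarrow> bool" where
  "antichain A \<longleftrightarrow> bot \<notin> A \<and> pairwise (\<lambda>x y. inf x y = bot) A"

definition ccc :: "'a::boolean_algebra itself \<Rightarrow> bool" where
  "ccc _ \<longleftrightarrow> (\<forall>A :: 'a set. antichain A \<longrightarrow> countable A)"

definition boolean_subalgebra :: "'a::boolean_algebra set \<Rightarrow> bool" where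
  "boolean_subalgebra D \<longleftrightarrow> bot \<in> D \<and> top \<in> D \<and> (\<forall>x\<in>D. - x \<in> D)
     \<and> (\<forall>x\<in>D. \<forall>y\<in>D. inf x y \<in> D \<and> sup x y \<in> D)"

definition dense_subalgebra :: "'a::boolean_algebra set \<Rightarrow> bool" where
  "dense_subalgebra D \<longleftrightarrow> boolean_subalgebra D \<and> (\<forall>b. b \<noteq> bot \<longrightarrow> (\<exists>d\<in>D. d \<noteq> bot \<and> d \<le> b))"

definition ultrafilter :: "'a::boolean_algebra set \<Rightarrow> bool" where
  "ultrafilter U \<longleftrightarrow> top \<in> U \<and> bot \<notin> U
     \<and> (\<forall>x\<in>U. \<forall>y\<in>U. inf x y \<in> U)
     \<and> (\<forall>x\<in>U. \<forall>y. x \<le> y \<longrightarrow> y \<in> U)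
     \<and> (\<forall>x. x \<in> U \<or> - x \<in> U)"

definition principal_filter :: "'a::boolean_algebra set \<Rightarrow> bool" where
  "principal_filter U \<longleftrightarrow> (\<exists>b. U = {x. b \<le> x})"

definition tukey_le ::
    "'d set \<Rightarrow> ('d \<Rightarrow> 'd \<Rightarrow> bool) \<Rightarrow> 'e set \<Rightarrow> ('e \<Rightarrow> 'e \<Rightarrow> bool) \<Rightarrow> bool" where
  "tukey_le D leD E leE \<longleftrightarrow>
     (\<exists>f \<in> D \<rightarrow> E. \<exists>g \<in> E \<rightarrow> D. \<forall>d\<in>D. \<forall>e\<in>E. leE (f d) e \<longrightarrow> leD d (g e))"

definition tukey_maximal :: "'a::boolean_algebra set \<Rightarrow> bool" where
  "tukey_maximal U \<longleftrightarrow> tukey_le (Fpow (UNIV :: 'a set)) (\<subseteq>) U (\<ge>)"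

end

theory Submission
  imports Defs
begin

text \<open>Let \<open>D\<close> be the small dense subalgebra. A transfinite construction of continuum length yields an
  ultrafilter \<open>U\<close> with a P-point property: it handles one decreasing sequence of the algebra at a time
  and keeps its filter base smaller than the dominating number. The base contains the complements of
  all atoms, which lie in \<open>D\<close>, so that \<open>U\<close> is non-principal. If \<open>U\<close> were Tukey maximal, there would
  be a family of continuum many members of \<open>U\<close> such that each member of \<open>U\<close> lies below only finitely many.
  The topology in which \<open>x\<close> is described by the elements of \<open>D\<close> below \<open>x\<close> and below \<open>- x\<close> has weight
  less than the continuum, so some member of the family is an accumulation point, and by c.c.c. a sequence
  of the family approximates it along a countable maximal antichain of \<open>D\<close>. The P-point property gives
  infinitely many terms of this sequence a common lower bound in \<open>U\<close>, a contradiction.\<close>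

section \<open>Cardinalities of sequence spaces and of families of finite sets\<close>

lemma continuum_eq: "continuum = |UNIV :: (nat \<Rightarrow> bool) set|"
  by (simp add: cexp_def ctwo_def Field_natLeq Field_card_of Func_def)

lemma infinite_nat_bool: "infinite (UNIV :: (nat \<Rightarrow> bool) set)"
proof -
  have "inj (\<lambda>n m :: nat. m = n)"
    by (rule injI) metis
  then show ?thesis
    by (metis finite_imageD infinite_UNIV_nat infinite_super subset_UNIV)
qed

text \<open>Code each term by a sequence of bits and flatten the resulting matrix with
  \<open>prod_decode\<close>. This bounds the number of tasks in the transfinite
  construction.\<close>

lemma card_of_nat_fun_ordLeq:
  assumes "|UNIV :: 'a set| \<le>o |UNIV :: (nat \<Rightarrow> bool) set|"
  shows "|UNIV :: (nat \<Rightarrow> 'a) set| \<le>o |UNIV :: (nat \<Rightarrow> bool) set|"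
proof -
  obtain i :: "'a \<Rightarrow> nat \<Rightarrow> bool" where i: "inj i"
    using assms card_of_ordLeq[of "UNIV::'a set" "UNIV :: (nat \<Rightarrow> bool) set"] by auto
  define j where "j = (\<lambda>(f :: nat \<Rightarrow> 'a) n. case prod_decode n of (k, l) \<Rightarrow> i (f k) l)"
  have "inj j"
  proof (rule injI)
    fix f g assume eq: "j f = j g"
    have "i (f k) l = i (g k) l" for k l
      using fun_cong[OF eq, of "prod_encode (k, l)"] by (simp add: j_def)
    then have "i (f k) = i (g k)" for k
      by blast
    then show "f = g"
      using i by (auto dest: injD)
  qed
  then show ?thesis
    using card_of_ordLeq[of "UNIV::(nat \<Rightarrow> 'a) set" "UNIV :: (nat \<Rightarrow> bool) set"] by auto
qed

lemma card_of_finite_ordLess_infinite: "finite A \<Longrightarrow> infinite B \<Longrightarrow> |A| <o |B|"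
  using finite_ordLess_infinite[of "|A|" "|B|"] card_of_Well_order[of A] card_of_Well_order[of B]
  by (simp add: Field_card_of)

lemma card_of_Fpow_ordLeq_infinite:
  assumes "infinite A"
  shows "|Fpow A| \<le>o |A|"
proof -
  define P where "P n = {S. S \<subseteq> A \<and> finite S \<and> card S = n}" for n
  have P: "|P n| \<le>o |A|" for n
  proof (induction n)
    case 0
    have "P 0 = {{}}"
      by (auto simp: P_def)
    then show ?case
      using assms by (simp add: ordLess_imp_ordLeq card_of_finite_ordLess_infinite)
  next
    case (Suc n)
    have "P (Suc n) \<subseteq> (\<lambda>(x, S). insert x S) ` (A \<times> P n)"
    proof
      fix S assume "S \<in> P (Suc n)"
      then have "S \<subseteq> A" "finite S" "card S = Suc n"
        by (simp_all add: P_def)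
      then obtain x S' where "S = insert x S'" "x \<in> A" "S' \<in> P n"
        by (auto simp: P_def card_Suc_eq)
      then show "S \<in> (\<lambda>(x, S). insert x S) ` (A \<times> P n)"
        by force
    qed
    then have "|P (Suc n)| \<le>o |A \<times> P n|"
      by (rule surj_imp_ordLeq)
    also have "|A \<times> P n| \<le>o |A|"
      using assms by (intro card_of_Times_ordLeq_infinite_Field card_of_Card_order Suc)
        (simp_all add: Field_card_of card_of_mono1)
    finally show ?case .
  qed
  have "Fpow A = (\<Union>n. P n)"
    by (auto simp: P_def Fpow_def)
  then show ?thesis
    using card_of_UNION_ordLeq_infinite[of A "UNIV :: nat set" P] assms P
    by (simp add: infinite_iff_card_of_nat)
qed

lemma card_of_Fpow_ordLess_infinite:
  assumes "infinite C" "|A| <o |C|"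
  shows "|Fpow A| <o |C|"
proof (cases "finite A")
  case True
  then have "finite (Fpow A)"
    by (auto simp: Fpow_def)
  then show ?thesis
    using assms(1) by (simp add: card_of_finite_ordLess_infinite)
next
  case False
  then show ?thesis
    using card_of_Fpow_ordLeq_infinite assms(2) ordLeq_ordLess_trans by blast
qed

section \<open>The dominating number and the finite intersection property\<close>

lemma not_dominating:
  fixes G :: "(nat \<Rightarrow> nat) set"
  assumes "|G| <o dominating_number"
  obtains g where "\<And>h. h \<in> G \<Longrightarrow> \<exists>n. h n < g n"
proof -
  have "\<not> dominating G"
    using assms dominating_number_least not_ordLess_ordLeq by blast
  then obtain g where g: "\<And>h. h \<in> G \<Longrightarrow> \<not> (\<forall>\<^sub>F n in sequentially. g n \<le> h n)"
    by (auto simp: dominating_def)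
  have "\<exists>n. h n < g n" if "h \<in> G" for h
  proof (rule ccontr)
    assume "\<not> ?thesis"
    then show False
      using g[OF that] by (auto simp: not_less)
  qed
  then show ?thesis
    by (rule that)
qed

text \<open>\<open>F\<close> generates a proper filter. The empty \<open>S\<close> counts and has
  meet \<open>top\<close>, so the property also forces \<open>top\<close> and \<open>bot\<close> to
  differ.\<close>

definition fip :: "'a::{boolean_algebra, complete_lattice} set \<Rightarrow> bool" where
  "fip F \<longleftrightarrow> (\<forall>S\<in>Fpow F. Inf S \<noteq> bot)"

lemma fip_mono: "fip F \<Longrightarrow> G \<subseteq> F \<Longrightarrow> fip G"
  by (auto simp: fip_def Fpow_def)

lemma fip_insertI:
  assumes "\<And>S. S \<in> Fpow F \<Longrightarrow> inf y (Inf S) \<noteq> bot"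
  shows "fip (insert y F)"
  unfolding fip_def
proof
  fix S assume S: "S \<in> Fpow (insert y F)"
  have "inf y (Inf (S - {y})) \<noteq> bot"
    using S by (intro assms) (auto simp: Fpow_def)
  moreover have "inf y (Inf (S - {y})) \<le> Inf S"
    by (metis Inf_insert Inf_superset_mono insert_Diff_single subset_insertI)
  ultimately show "Inf S \<noteq> bot"
    by (metis bot.extremum_unique)
qed

text \<open>The undominated \<open>g\<close> is taken above the functions \<open>n \<mapsto> h S n\<close> for finite meets \<open>Inf S\<close> of \<open>F\<close>,
  where \<open>h S n\<close> is an index with \<open>Inf S \<sqinter> x n\<close> not below \<open>b (h S n)\<close>. One \<open>n\<close> with \<open>h S n < g n\<close>
  makes \<open>y = (SUP n. x n \<sqinter> - b (g n))\<close> compatible with \<open>Inf S\<close>, whereas every \<open>g\<close> makes \<open>y\<close> a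
  pseudo-intersection of \<open>x\<close> along \<open>b\<close>.\<close>

lemma fip_insert_pseudo_intersection:
  fixes F :: "'a::{boolean_algebra, complete_lattice} set" and x b :: "nat \<Rightarrow> 'a"
  assumes "|Fpow F| <o dominating_number"
    and fip: "fip (F \<union> range x)"
    and x: "antimono x" and b: "antimono b" "(INF n. b n) = bot"
  obtains y where "fip (insert y F)" "y \<le> x 0" "\<And>m. \<exists>k. inf y (b k) \<le> x m"
proof -
  have "\<exists>k. \<not> inf (Inf S) (x n) \<le> b k" if S: "S \<in> Fpow F" for S n
  proof (rule ccontr)
    assume "\<not> ?thesis"
    then have "inf (Inf S) (x n) \<le> (INF k. b k)"
      by (auto intro: INF_greatest)
    then have "Inf (insert (x n) S) = bot"
      using b(2) by (simp add: bot.extremum_unique inf_commute)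
    moreover have "insert (x n) S \<in> Fpow (F \<union> range x)"
      using S by (auto simp: Fpow_def)
    ultimately show False
      using fip by (auto simp: fip_def)
  qed
  then obtain h where h: "\<And>S n. S \<in> Fpow F \<Longrightarrow> \<not> inf (Inf S) (x n) \<le> b (h S n)"
    by metis
  have "|h ` Fpow F| <o dominating_number"
    using card_of_image assms(1) ordLeq_ordLess_trans by blast
  then obtain g where "\<And>k. k \<in> h ` Fpow F \<Longrightarrow> \<exists>n. k n < g n"
    by (rule not_dominating) blast
  then have g: "\<exists>n. h S n < g n" if "S \<in> Fpow F" for S
    using that by blast
  define y where "y = (SUP n. inf (x n) (- b (g n)))"
  have "fip (insert y F)"
  proof (rule fip_insertI)
    fix S assume S: "S \<in> Fpow F"
    obtain n where n: "h S n < g n"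
      using g S by blast
    then have "\<not> inf (Inf S) (x n) \<le> b (g n)"
      using h[OF S, of n] antimonoD[OF b(1), of "h S n" "g n"] by auto
    then have "inf (inf (Inf S) (x n)) (- b (g n)) \<noteq> bot"
      by (simp add: inf_shunt)
    moreover have "inf (x n) (- b (g n)) \<le> y"
      unfolding y_def by (rule SUP_upper) simp
    then have "inf (inf (Inf S) (x n)) (- b (g n)) \<le> inf y (Inf S)"
      by (metis inf.commute inf.left_commute inf_mono order_refl)
    ultimately show "inf y (Inf S) \<noteq> bot"
      by (metis bot.extremum_unique)
  qed
  moreover have "y \<le> x 0"
    unfolding y_def using x by (auto intro!: SUP_least le_infI1 simp: antimono_def)
  moreover have "\<exists>k. inf y (b k) \<le> x m" for m
  proof -
    \<comment> \<open>The terms of \<open>y\<close> with \<open>n \<le> m\<close> lie outside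
      \<open>b k\<close>, the later ones below \<open>x m\<close>.\<close>
    define k where "k = Max (g ` {..m})"
    have "inf (x n) (- b (g n)) \<le> sup (- b k) (x m)" for n
    proof (cases "n \<le> m")
      case True
      then have "g n \<le> k"
        by (simp add: k_def)
      then have "- b (g n) \<le> - b k"
        using b(1) by (simp add: antimono_def)
      then show ?thesis
        by (meson le_infI2 le_supI1)
    next
      case False
      then have "x n \<le> x m"
        using x by (simp add: antimono_def)
      then show ?thesis
        by (meson le_infI1 le_supI2)
    qed
    then have "y \<le> sup (- b k) (x m)"
      unfolding y_def by (rule SUP_least)
    then show ?thesis
      using shunt1[of y "b k" "x m"] by blast
  qed
  ultimately show ?thesis
    by (rule that)
qed

lemma fip_Union_chain:
  assumes "subset.chain UNIV \<C>" "\<C> \<noteq> {}" "\<And>F. F \<in> \<C> \<Longrightarrow> fip F"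
  shows "fip (\<Union>\<C>)"
  unfolding fip_def
proof
  fix S assume "S \<in> Fpow (\<Union>\<C>)"
  then have "finite S" "S \<subseteq> \<Union>\<C>"
    by (auto simp: Fpow_def)
  then obtain F where "F \<in> \<C>" "S \<subseteq> F"
    using assms(1,2) finite_subset_Union_chain by metis
  then show "Inf S \<noteq> bot"
    using assms(3) \<open>finite S\<close> by (auto simp: fip_def Fpow_def)
qed

text \<open>The stages form a chain, so the property survives limits. This justifies afterwards a
  recursion whose clauses assume \<open>fip\<close> of the stage reached.\<close>

lemma fip_transfinite:
  fixes c :: "'t \<Rightarrow> 'a::{boolean_algebra, complete_lattice}"
  assumes r: "Well_order r" "Field r = UNIV"
    and F: "fip F"
    and step: "\<And>t. fip (F \<union> c ` underS r t) \<Longrightarrow> fip (insert (c t) (F \<union> c ` underS r t))"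
  shows "fip (F \<union> range c)"
proof -
  define H where "H t = insert (c t) (F \<union> c ` underS r t)" for t
  have trans: "trans r" and total: "total r" and wf: "wf (r - Id)" and refl: "\<And>t. (t, t) \<in> r"
    using r by (auto simp: well_order_on_def linear_order_on_def partial_order_on_def
        preorder_on_def refl_on_def)
  have H: "H t = F \<union> c ` {s. (s, t) \<in> r}" for t
    using refl by (auto simp: H_def underS_def)
  \<comment> \<open>Including \<open>F\<close> keeps the chain nonempty when \<open>A\<close> is
    empty, as at the least \<open>t\<close>.\<close>
  have chain: "subset.chain UNIV (insert F (H ` A))" for A
    unfolding subset_chain_def
  proof (intro conjI ballI)
    have "H s \<subseteq> H t" if "(s, t) \<in> r" for s t
      using that trans by (auto simp: H dest: transD)
    then have "H s \<subseteq> H t \<or> H t \<subseteq> H s" for s t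
      using total refl by (metis UNIV_I total_on_def)
    moreover have "F \<subseteq> H t" for t
      by (auto simp: H)
    ultimately show "X \<subseteq> Y \<or> Y \<subseteq> X" if "X \<in> insert F (H ` A)" "Y \<in> insert F (H ` A)" for X Y
      using that by blast
  qed simp
  have *: "fip (F \<union> c ` A)" if "\<And>t. t \<in> A \<Longrightarrow> fip (H t)" for A
  proof (rule fip_mono)
    show "fip (\<Union>(insert F (H ` A)))"
      using chain that F by (intro fip_Union_chain) auto
    show "F \<union> c ` A \<subseteq> \<Union>(insert F (H ` A))"
      by (auto simp: H_def)
  qed
  have "fip (H t)" for t
    using wf
  proof (induction t rule: wf_induct_rule)
    case (less t)
    then have "fip (F \<union> c ` underS r t)"
      by (intro *) (auto simp: underS_def)
    then show ?case
      unfolding H_def by (rule step)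
  qed
  then show ?thesis
    by (rule *)
qed

section \<open>Ultrafilters with the P-point property\<close>

lemma ultrafilter_Inf:
  fixes U :: "'a::{boolean_algebra, complete_lattice} set"
  assumes "ultrafilter U" "finite S" "S \<subseteq> U"
  shows "Inf S \<in> U"
  using assms(2,3,1) by induction (auto simp: ultrafilter_def)

lemma ultrafilter_fip: "ultrafilter U \<Longrightarrow> fip U"
  unfolding fip_def Fpow_def using ultrafilter_Inf[of U] by (metis mem_Collect_eq ultrafilter_def)

text \<open>With \<open>b n\<close> the complement of the join of the first \<open>n\<close> elements of a maximal antichain, this says
  that \<open>y\<close> is a pseudo-intersection of the \<open>x m\<close> modulo the ideal generated by the antichain.\<close>

definition p_ultrafilter :: "'a::{boolean_algebra, complete_lattice} set \<Rightarrow> bool" where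
  "p_ultrafilter U \<longleftrightarrow> ultrafilter U \<and>
     (\<forall>(x :: nat \<Rightarrow> 'a) (b :: nat \<Rightarrow> 'a). antimono x \<and> range x \<subseteq> U \<and> antimono b \<and> (INF n. b n) = bot \<longrightarrow>
        (\<exists>y\<in>U. \<forall>m. \<exists>k. inf y (b k) \<le> x m))"

text \<open>Each pair \<open>(x, b)\<close> is a task. In the cardinal order of the at most
  continuum many tasks, each has fewer than continuum many predecessors, so the base at its turn is
  smaller than the dominating number and a pseudo-intersection can be added.\<close>

lemma ex_p_ultrafilter:
  fixes F :: "'a::{boolean_algebra, complete_lattice} set"
  assumes d: "dominating_number =o |UNIV :: (nat \<Rightarrow> bool) set|"
    and card: "|UNIV :: 'a set| \<le>o |UNIV :: (nat \<Rightarrow> bool) set|"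
    and F: "|F| <o |UNIV :: (nat \<Rightarrow> bool) set|" "fip F"
  obtains U where "p_ultrafilter U" "F \<subseteq> U"
proof -
  let ?r = "|UNIV :: ((nat \<Rightarrow> 'a) \<times> (nat \<Rightarrow> 'a)) set|"
  define G where "G c t = F \<union> c ` underS ?r t" for c :: "(nat \<Rightarrow> 'a) \<times> (nat \<Rightarrow> 'a) \<Rightarrow> 'a" and t
  \<comment> \<open>Compatibility with the base \<open>E\<close> reached so far stands in for
    membership in \<open>U\<close>, which does not exist yet.\<close>
  define T where "T E t \<longleftrightarrow> antimono (fst t) \<and> antimono (snd t) \<and> (INF n. snd t n) = bot \<and>
    fip (E \<union> range (fst t))" for E and t :: "(nat \<Rightarrow> 'a) \<times> (nat \<Rightarrow> 'a)"
  \<comment> \<open>Being conditional on \<open>fip (G c t)\<close>, the requirement can be met for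
    any \<open>c\<close>; the condition is discharged later by
    \<open>fip_transfinite\<close>.\<close>
  define P where "P c t y \<longleftrightarrow> (fip (G c t) \<longrightarrow> fip (insert y (G c t)) \<and>
    (T (G c t) t \<longrightarrow> y \<le> fst t 0 \<and> (\<forall>m. \<exists>k. inf y (snd t k) \<le> fst t m)))" for c t y
  have wo: "Well_order ?r" "Field ?r = UNIV"
    using card_of_Well_order by (auto simp: Field_card_of)
  have "\<exists>c. \<forall>t. P c t (c t)"
  proof (rule dependent_wf_choice)
    show "wf (?r - Id)"
      using wo by (simp add: well_order_on_def)
    show "P c t y = P c' t y" if "\<And>s. (s, t) \<in> ?r - Id \<Longrightarrow> c s = c' s" for c c' t y
    proof -
      have "G c t = G c' t"
        using that by (auto simp: G_def underS_def image_iff)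
      then show ?thesis
        by (simp add: P_def)
    qed
    show "\<exists>y. P c t y" for c t
    proof (cases "T (G c t) t")
      case True
      have "|underS ?r t| <o ?r"
        by (rule card_of_underS[OF card_of_Card_order]) (simp add: Field_card_of)
      also have "?r \<le>o |UNIV :: (nat \<Rightarrow> bool) set|"
        using card_of_Times_ordLeq_infinite_Field[OF _ card_of_nat_fun_ordLeq[OF card]
            card_of_nat_fun_ordLeq[OF card] card_of_Card_order]
        by (simp add: Field_card_of infinite_nat_bool)
      finally have "|c ` underS ?r t| <o |UNIV :: (nat \<Rightarrow> bool) set|"
        using card_of_image ordLeq_ordLess_trans by blast
      then have "|G c t| <o |UNIV :: (nat \<Rightarrow> bool) set|"
        unfolding G_def using F(1) infinite_nat_bool by (intro card_of_Un_ordLess_infinite)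
      then have "|Fpow (G c t)| <o dominating_number"
        using card_of_Fpow_ordLess_infinite infinite_nat_bool d ordIso_symmetric ordLess_ordIso_trans
        by blast
      then show ?thesis
        using True fip_insert_pseudo_intersection[of "G c t" "fst t" "snd t"]
        unfolding P_def T_def by metis
    next
      case False
      \<comment> \<open>A pair that poses no task receives the harmless element
        \<open>top\<close>.\<close>
      have "P c t top"
        unfolding P_def using False fip_insertI[of "G c t" top] by (auto simp: fip_def)
      then show ?thesis ..
    qed
  qed
  then obtain c where c: "\<And>t. P c t (c t)"
    by blast
  define W where "W = F \<union> range c"
  have G_W: "G c t \<subseteq> W" for t
    by (auto simp: G_def W_def)
  have W: "fip W"
    unfolding W_def
  proof (rule fip_transfinite[OF wo F(2)])
    show "fip (insert (c t) (F \<union> c ` underS ?r t))" if "fip (F \<union> c ` underS ?r t)" for t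
      using that c[of t] by (simp add: P_def G_def)
  qed
  have c_task: "c t \<le> fst t 0" "\<exists>k. inf (c t) (snd t k) \<le> fst t m" if "T (G c t) t" for t m
    using that c[of t] fip_mono[OF W G_W] by (auto simp: P_def)
  define U where "U = {u. \<exists>S\<in>Fpow W. Inf S \<le> u}"
  have W_U: "W \<subseteq> U"
  proof
    fix w assume "w \<in> W"
    then show "w \<in> U"
      unfolding U_def by (auto intro!: bexI[of _ "{w}"] simp: Fpow_def)
  qed
  have U: "ultrafilter U"
    unfolding ultrafilter_def
  proof (intro conjI ballI allI impI)
    show "top \<in> U"
      by (auto simp: U_def Fpow_def)
    show "bot \<notin> U"
      using W by (auto simp: U_def fip_def bot.extremum_unique)
    show "inf u v \<in> U" if uv: "u \<in> U" "v \<in> U" for u v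
    proof -
      obtain S S' where S: "S \<in> Fpow W" "Inf S \<le> u" "S' \<in> Fpow W" "Inf S' \<le> v"
        using uv unfolding U_def by blast
      then have "Inf (S \<union> S') \<le> inf u v"
        by (simp add: Inf_union_distrib inf_mono le_infI1 le_infI2)
      then show ?thesis
        using S unfolding U_def by (intro CollectI bexI[of _ "S \<union> S'"]) (auto simp: Fpow_def)
    qed
    show "v \<in> U" if "u \<in> U" "u \<le> v" for u v
      using that order_trans by (auto simp: U_def)
    show "u \<in> U \<or> - u \<in> U" for u
    proof -
      \<comment> \<open>The element chosen for a constant sequence \<open>u\<close> lies below \<open>u\<close>.\<close>
      let ?t = "(\<lambda>_. u, \<lambda>_. bot) :: (nat \<Rightarrow> 'a) \<times> (nat \<Rightarrow> 'a)"
      show ?thesis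
      proof (cases "fip (insert u (G c ?t))")
        case True
        then have "c ?t \<le> u"
          using c_task(1)[of ?t] by (simp add: T_def antimono_def)
        then show ?thesis
          unfolding U_def by (intro disjI1 CollectI bexI[of _ "{c ?t}"]) (auto simp: W_def Fpow_def)
      next
        case False
        then obtain S where "S \<in> Fpow (G c ?t)" "inf u (Inf S) = bot"
          using fip_insertI by metis
        moreover from this have "Inf S \<le> - u"
          by (metis inf.commute inf_shunt)
        ultimately show ?thesis
          unfolding U_def using G_W[of ?t]
          by (intro disjI2 CollectI bexI[of _ S]) (auto simp: Fpow_def)
      qed
    qed
  qed
  have "\<exists>y\<in>U. \<forall>m. \<exists>k. inf y (b k) \<le> x m"
    if "antimono x" "range x \<subseteq> U" "antimono b" "(INF n. b n) = bot"
    for x b :: "nat \<Rightarrow> 'a"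
  proof -
    have "fip (G c (x, b) \<union> range x)"
      using G_W W_U that(2) by (intro fip_mono[OF ultrafilter_fip[OF U]]) blast
    then have "T (G c (x, b)) (x, b)"
      using that by (simp add: T_def)
    then show ?thesis
      using c_task(2)[of "(x, b)"] W_U by (intro bexI[of _ "c (x, b)"]) (auto simp: W_def)
  qed
  then have "p_ultrafilter U"
    using U by (auto simp: p_ultrafilter_def)
  then show ?thesis
    using that W_U by (auto simp: W_def)
qed

section \<open>Atoms and non-principal ultrafilters\<close>

definition atoms :: "'a::boolean_algebra set" where
  "atoms = {p. p \<noteq> bot \<and> (\<forall>q\<le>p. q = bot \<or> q = p)}"

text \<open>The generator \<open>b\<close> of a principal ultrafilter is an atom, since
  \<open>q\<close> or \<open>- q\<close> is a member for every \<open>q \<le> b\<close>; but then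
  \<open>- b\<close> is a member too.\<close>

lemma not_principal_filterI:
  assumes U: "ultrafilter U" and atoms: "uminus ` atoms \<subseteq> U"
  shows "\<not> principal_filter U"
proof
  assume "principal_filter U"
  then obtain b where b: "U = {x. b \<le> x}"
    by (auto simp: principal_filter_def)
  have "b \<noteq> bot"
    using U b by (auto simp: ultrafilter_def)
  moreover have "q = bot \<or> q = b" if "q \<le> b" for q
  proof -
    have "b \<le> q \<or> b \<le> - q"
      using U b by (auto simp: ultrafilter_def)
    moreover have "q = bot" if "b \<le> - q"
      using inf_shunt[of q q] \<open>q \<le> b\<close> that by auto
    ultimately show ?thesis
      using that by auto
  qed
  ultimately have "- b \<in> U"
    using atoms by (auto simp: atoms_def)
  then show False
    using b inf_shunt[of b b] \<open>b \<noteq> bot\<close> by auto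
qed

text \<open>If finitely many atoms had join \<open>top\<close>, every element would be determined by
  those of them below it, leaving only finitely many elements.\<close>

lemma fip_uminus_atoms:
  assumes "infinite (UNIV :: 'a::{boolean_algebra, complete_lattice} set)"
  shows "fip (uminus ` (atoms :: 'a set))"
  unfolding fip_def
proof (intro ballI notI)
  fix S :: "'a set" assume S: "S \<in> Fpow (uminus ` atoms)" and bot: "Inf S = bot"
  define A where "A x = {s \<in> S. - s \<le> x}" for x
  have le: "x \<le> y" if "A x \<subseteq> A y" for x y
  proof -
    have "inf x (- y) \<le> s" if "s \<in> S" for s
    proof (cases "- s \<le> x")
      case True
      then have "- s \<le> y"
        using \<open>A x \<subseteq> A y\<close> that by (auto simp: A_def)
      then show ?thesis
        by (metis compl_le_swap2 le_infI2)
    next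
      case False
      have "- s \<in> atoms"
        using S that by (auto simp: Fpow_def)
      then have "inf x (- s) = bot"
        using False inf.absorb_iff2[of "- s" x] inf_le2[of x "- s"] unfolding atoms_def by blast
      then show ?thesis
        using inf_shunt[of x "- s"] by (simp add: le_infI1)
    qed
    then have "inf x (- y) \<le> bot"
      unfolding bot[symmetric] by (rule Inf_greatest)
    then show ?thesis
      using inf_shunt[of x "- y"] bot.extremum_unique by auto
  qed
  have "inj A"
    by (rule injI, rule antisym; rule le) simp_all
  moreover have "finite (range A)"
    by (rule finite_subset[of _ "Pow S"]) (use S in \<open>auto simp: A_def Fpow_def\<close>)
  ultimately show False
    using assms finite_imageD[of A UNIV] by blast
qed

section \<open>Dense subalgebras, antichains and accumulation points\<close>

lemma dense_subalgebra_leI: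
  assumes "dense_subalgebra D" "\<And>d. d \<in> D \<Longrightarrow> d \<le> x \<Longrightarrow> d \<le> y"
  shows "x \<le> y"
proof (rule ccontr)
  assume "\<not> x \<le> y"
  then have "inf x (- y) \<noteq> bot"
    by (simp add: inf_shunt)
  then obtain d where d: "d \<in> D" "d \<noteq> bot" "d \<le> inf x (- y)"
    using assms(1) by (auto simp: dense_subalgebra_def)
  then have "d \<le> y" "d \<le> - y"
    using assms(2) by auto
  then show False
    using d(2) by (metis inf.absorb_iff1 inf_shunt)
qed

lemma infinite_dense_subalgebra:
  assumes "dense_subalgebra D" "infinite (UNIV :: 'a::boolean_algebra set)"
  shows "infinite (D :: 'a set)"
proof
  assume "finite D"
  then have "finite (range (\<lambda>x. {d \<in> D. d \<le> x}))"
    by (simp add: finite_subset[of _ "Pow D"] image_subset_iff)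
  moreover have "inj (\<lambda>x. {d \<in> D. d \<le> x})"
    using dense_subalgebra_leI[OF assms(1)] by (intro injI antisym) blast+
  ultimately show False
    using assms(2) finite_imageD[of "\<lambda>x. {d \<in> D. d \<le> x}" UNIV] by blast
qed

text \<open>Density below an atom can only return the atom itself.\<close>

lemma atoms_subset_dense_subalgebra: "dense_subalgebra D \<Longrightarrow> atoms \<subseteq> D"
  unfolding atoms_def dense_subalgebra_def by blast

lemma boolean_subalgebra_Sup:
  fixes D :: "'a::{boolean_algebra, complete_lattice} set"
  assumes "boolean_subalgebra D" "finite S" "S \<subseteq> D"
  shows "Sup S \<in> D"
  using assms(2,3,1) by induction (auto simp: boolean_subalgebra_def)

lemma ex_maximal_antichain:
  fixes E :: "'a::boolean_algebra set"
  obtains M where "M \<subseteq> E" "antichain M"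
    "\<And>x. x \<in> E \<Longrightarrow> x \<noteq> bot \<Longrightarrow> (\<And>m. m \<in> M \<Longrightarrow> inf x m = bot) \<Longrightarrow> x \<in> M"
proof -
  have "\<exists>M\<in>{M. M \<subseteq> E \<and> antichain M}. \<forall>X\<in>{M. M \<subseteq> E \<and> antichain M}. M \<subseteq> X \<longrightarrow> X = M"
  proof (rule subset_Zorn')
    fix \<C> assume C: "subset.chain {M. M \<subseteq> E \<and> antichain M} \<C>"
    have "inf x y = bot" if xy: "x \<in> \<Union>\<C>" "y \<in> \<Union>\<C>" "x \<noteq> y" for x y
    proof -
      obtain X Y where "X \<in> \<C>" "Y \<in> \<C>" "x \<in> X" "y \<in> Y"
        using xy by blast
      moreover from this have "X \<subseteq> Y \<or> Y \<subseteq> X"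
        using C by (simp add: subset_chain_def)
      ultimately obtain Z where "Z \<in> \<C>" "x \<in> Z" "y \<in> Z"
        by blast
      then show ?thesis
        using C xy(3) by (auto simp: subset_chain_def antichain_def pairwise_def)
    qed
    then show "\<Union>\<C> \<in> {M. M \<subseteq> E \<and> antichain M}"
      using C by (auto simp: subset_chain_def antichain_def pairwise_def)
  qed
  then obtain M where M: "M \<subseteq> E" "antichain M"
    and max: "\<And>X. X \<subseteq> E \<Longrightarrow> antichain X \<Longrightarrow> M \<subseteq> X \<Longrightarrow> X = M"
    by auto
  show ?thesis
  proof (rule that[OF M])
    fix x assume "x \<in> E" "x \<noteq> bot" "\<And>m. m \<in> M \<Longrightarrow> inf x m = bot"
    then have "insert x M = M"
      using M by (intro max) (auto simp: antichain_def pairwise_insert inf_commute)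
    then show "x \<in> M"
      by blast
  qed
qed

text \<open>The members of \<open>D\<close> below \<open>w\<close> or below \<open>- w\<close> are
  dense, so a maximal antichain \<open>A\<close> of them has join \<open>top\<close>; c.c.c. makes
  it countable. Finite joins of its elements on either side of \<open>w\<close> stay in
  \<open>D\<close>.\<close>

lemma ccc_approximation:
  fixes D :: "'a::{boolean_algebra, complete_lattice} set"
  assumes ccc: "ccc TYPE('a)" and D: "dense_subalgebra D"
  obtains d e :: "nat \<Rightarrow> 'a"
  where "range d \<subseteq> D" "range e \<subseteq> D" "\<And>n. d n \<le> w" "\<And>n. e n \<le> - w"
    "antimono (\<lambda>n. - sup (d n) (e n))" "(INF n. - sup (d n) (e n)) = bot"
proof -
  obtain A where A: "A \<subseteq> {x \<in> D. x \<le> w \<or> x \<le> - w}" "antichain A"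
    and max: "\<And>x. x \<in> {x \<in> D. x \<le> w \<or> x \<le> - w} \<Longrightarrow> x \<noteq> bot \<Longrightarrow>
      (\<And>a. a \<in> A \<Longrightarrow> inf x a = bot) \<Longrightarrow> x \<in> A"
    by (rule ex_maximal_antichain) blast
  have "countable A"
    using ccc A(2) by (auto simp: ccc_def)
  then obtain s :: "nat \<Rightarrow> 'a" where s: "A \<subseteq> range s"
    using subset_range_from_nat_into by blast
  \<comment> \<open>Only \<open>A \<subseteq> range s\<close> is known, and \<open>A\<close> may be
    empty, hence the test \<open>s i \<in> A\<close>.\<close>
  define d where "d n = Sup (s ` {i. i < n \<and> s i \<in> A \<and> s i \<le> w})" for n
  define e where "e n = Sup (s ` {i. i < n \<and> s i \<in> A \<and> s i \<le> - w})" for n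
  show ?thesis
  proof (rule that)
    have "d n \<in> D" "e n \<in> D" for n
      using A(1) D unfolding d_def e_def dense_subalgebra_def
      by (auto intro!: boolean_subalgebra_Sup)
    then show "range d \<subseteq> D" "range e \<subseteq> D"
      by auto
    show "d n \<le> w" "e n \<le> - w" for n
      unfolding d_def e_def by (auto intro: Sup_least)
    have "d m \<le> d n" "e m \<le> e n" if "m \<le> n" for m n
      unfolding d_def e_def using that by (auto intro!: Sup_subset_mono)
    then show "antimono (\<lambda>n. - sup (d n) (e n))"
      by (intro antimonoI compl_mono sup_mono)
    show "(INF n. - sup (d n) (e n)) = bot" (is "?z = bot")
    proof (rule ccontr)
      assume "?z \<noteq> bot"
      then obtain z where z: "z \<in> D" "z \<noteq> bot" "z \<le> ?z"
        using D unfolding dense_subalgebra_def by blast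
      \<comment> \<open>Shrinking \<open>z\<close> to an element \<open>q\<close> that decides
        \<open>w\<close> makes the maximality of \<open>A\<close> applicable: \<open>q\<close> would
        be a member of \<open>A\<close> disjoint from itself.\<close>
      have "\<exists>q\<in>D. q \<noteq> bot \<and> q \<le> z \<and> (q \<le> w \<or> q \<le> - w)"
      proof (cases "inf z w = bot")
        case True
        then have "z \<le> - w"
          by (simp only: inf_shunt)
        then show ?thesis
          using z(1,2) by blast
      next
        case False
        then show ?thesis
          using D unfolding dense_subalgebra_def by (meson le_inf_iff)
      qed
      then obtain q where q: "q \<in> D" "q \<noteq> bot" "q \<le> ?z" "q \<le> w \<or> q \<le> - w"
        using z(3) order_trans by blast
      have disj: "inf q a = bot" if a: "a \<in> A" for a
      proof -
        obtain i where i: "a = s i"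
          using a s by blast
        have "a \<le> d (Suc i) \<or> a \<le> e (Suc i)"
          using A(1) a i unfolding d_def e_def by (auto intro!: Sup_upper)
        then have "a \<le> sup (d (Suc i)) (e (Suc i))"
          by (auto intro: le_supI1 le_supI2)
        moreover have "q \<le> - sup (d (Suc i)) (e (Suc i))"
          using q(3) by (rule order_trans) (rule INF_lower, simp)
        ultimately have "q \<le> - a"
          by (meson compl_mono order_trans)
        then show ?thesis
          by (simp add: inf_shunt)
      qed
      then have "q \<in> A"
        using q by (intro max) auto
      then show False
        using disj q(2) by fastforce
    qed
  qed
qed

text \<open>Otherwise the finite sets among the \<open>N (d, e)\<close> would cover the index type;
  there are at most \<open>|D|\<close> of them, so their union is too small.\<close>

lemma accumulation_point:
  fixes D :: "'a::boolean_algebra set" and \<phi> :: "'i \<Rightarrow> 'a"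
  assumes D: "infinite D" "|D| <o |UNIV :: 'i set|"
  obtains a where
    "\<And>d e. d \<in> D \<Longrightarrow> e \<in> D \<Longrightarrow> d \<le> \<phi> a \<Longrightarrow> e \<le> - \<phi> a \<Longrightarrow> infinite {i. d \<le> \<phi> i \<and> e \<le> - \<phi> i}"
proof -
  define N where "N = (\<lambda>(d, e). {i. d \<le> \<phi> i \<and> e \<le> - \<phi> i})"
  define B where "B = (\<Union>p \<in> {p \<in> D \<times> D. finite (N p)}. N p)"
  have "|{p \<in> D \<times> D. finite (N p)}| \<le>o |D \<times> D|"
    by (rule card_of_mono1) auto
  also have "|D \<times> D| \<le>o |D|"
    using D(1) card_of_Times_same_infinite ordIso_imp_ordLeq by blast
  finally have "|B| \<le>o |D|"
    unfolding B_def using D(1)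
    by (intro card_of_UNION_ordLeq_infinite)
      (auto intro: ordLess_imp_ordLeq card_of_finite_ordLess_infinite)
  then have "B \<noteq> UNIV"
    using D(2) not_ordLess_ordLeq by blast
  then obtain a where "a \<notin> B"
    by blast
  then show ?thesis
    by (intro that[of a]) (auto simp: B_def N_def)
qed

section \<open>Tukey maximality and the P-point property\<close>

lemma ex_inj_selection:
  fixes N :: "nat \<Rightarrow> 'i set"
  assumes "\<And>n. infinite (N n)"
  obtains a where "inj a" "\<And>n. a n \<in> N n"
proof -
  have "\<exists>a. \<forall>n. a n \<in> N n \<and> a n \<notin> a ` {..<n}"
  proof (rule dependent_wf_choice[OF wf_less])
    show "(r \<in> N n \<and> r \<notin> f ` {..<n}) = (r \<in> N n \<and> r \<notin> g ` {..<n})"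
      if "\<And>z. (z, n) \<in> {(x, y). x < y} \<Longrightarrow> f z = g z" for f g r n
      using that by (simp add: image_iff)
    show "\<exists>r. r \<in> N n \<and> r \<notin> f ` {..<n}" for f n
      using infinite_super[of "N n" "f ` {..<n}"] assms by blast
  qed
  then obtain a where a: "\<And>n. a n \<in> N n" "\<And>n. a n \<notin> a ` {..<n}"
    by blast
  then have "inj a"
    by (metis imageI injI lessThan_iff nat_neq_iff)
  then show ?thesis
    using a that by blast
qed

text \<open>The family is \<open>f\<close> on singletons: \<open>u \<le> f {i}\<close> puts
  \<open>i\<close> into the finite set \<open>g u\<close>.\<close>

lemma tukey_maximalD:
  fixes U :: "'a::boolean_algebra set"
  assumes "tukey_maximal U"
  obtains \<phi> :: "'a \<Rightarrow> 'a" where "range \<phi> \<subseteq> U" "\<And>u. u \<in> U \<Longrightarrow> finite {i. u \<le> \<phi> i}"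
proof -
  obtain f g where f: "f \<in> Fpow (UNIV :: 'a set) \<rightarrow> U" and g: "g \<in> U \<rightarrow> Fpow UNIV"
    and fg: "\<And>d u. d \<in> Fpow UNIV \<Longrightarrow> u \<in> U \<Longrightarrow> u \<le> f d \<Longrightarrow> d \<subseteq> g u"
    using assms by (auto simp: tukey_maximal_def tukey_le_def)
  show ?thesis
  proof (rule that[of "\<lambda>i. f {i}"])
    show "range (\<lambda>i. f {i}) \<subseteq> U"
      using f by (auto simp: Fpow_def)
    show "finite {i. u \<le> f {i}}" if "u \<in> U" for u
    proof (rule finite_subset)
      show "{i. u \<le> f {i}} \<subseteq> g u"
        using fg[of "{_}" u] that by (auto simp: Fpow_def)
      show "finite (g u)"
        using g that by (auto simp: Fpow_def)
    qed
  qed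
qed

text \<open>The argument of Dobrinen and Todorcevic for P-points. The \<open>\<phi> (a n)\<close> converge to \<open>\<phi> w\<close> in the
  topology generated by \<open>D\<close>, that is, \<open>\<phi> (a n)\<close> and \<open>\<phi> w\<close> agree outside \<open>b n\<close>. Hence a common lower
  bound \<open>y\<close> of the \<open>\<phi> (a (nn j))\<close> modulo \<open>b\<close> can fail to lie below \<open>\<phi> (a (nn j))\<close> only inside
  \<open>r j\<close>. As the \<open>r j\<close> are disjoint, \<open>U\<close> omits the join of the even or of the odd ones.\<close>

lemma p_ultrafilter_not_tukey_maximal:
  fixes U D :: "'a::{boolean_algebra, complete_lattice} set"
  assumes p: "p_ultrafilter U" and ccc: "ccc TYPE('a)"
    and D: "dense_subalgebra D" "infinite D" "|D| <o |UNIV :: 'a set|"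
  shows "\<not> tukey_maximal U"
proof
  assume "tukey_maximal U"
  then obtain \<phi> :: "'a \<Rightarrow> 'a" where \<phi>: "range \<phi> \<subseteq> U" "\<And>u. u \<in> U \<Longrightarrow> finite {i. u \<le> \<phi> i}"
    by (rule tukey_maximalD) blast
  have U: "ultrafilter U"
    using p by (simp add: p_ultrafilter_def)
  then have U_inf: "inf u v \<in> U" if "u \<in> U" "v \<in> U" for u v
    using that by (simp add: ultrafilter_def)
  obtain w where w: "\<And>d e. d \<in> D \<Longrightarrow> e \<in> D \<Longrightarrow> d \<le> \<phi> w \<Longrightarrow> e \<le> - \<phi> w \<Longrightarrow>
      infinite {i. d \<le> \<phi> i \<and> e \<le> - \<phi> i}"
    by (rule accumulation_point[OF D(2,3), where \<phi> = \<phi>]) blast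
  obtain d e :: "nat \<Rightarrow> 'a"
    where de: "range d \<subseteq> D" "range e \<subseteq> D" "\<And>n. d n \<le> \<phi> w" "\<And>n. e n \<le> - \<phi> w"
    and b': "antimono (\<lambda>n. - sup (d n) (e n))" "(INF n. - sup (d n) (e n)) = bot"
    by (rule ccc_approximation[OF ccc D(1), where w = "\<phi> w"]) (rule that)
  define b where "b n = - sup (d n) (e n)" for n
  have b: "antimono b" "(INF n. b n) = bot"
    using b' by (simp_all add: b_def[abs_def])
  have "infinite {i. d n \<le> \<phi> i \<and> e n \<le> - \<phi> i}" for n
    using de by (intro w) auto
  then obtain a :: "nat \<Rightarrow> 'a" where a: "inj a" "\<And>n. a n \<in> {i. d n \<le> \<phi> i \<and> e n \<le> - \<phi> i}"
    by (rule ex_inj_selection) (rule that)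
  \<comment> \<open>Outside \<open>b n\<close> the element \<open>\<phi> w\<close> reduces to
    \<open>d n\<close>, being disjoint from \<open>e n\<close>.\<close>
  have agree: "inf (\<phi> w) (- b n) \<le> \<phi> (a n)" for n
  proof -
    have "inf (\<phi> w) (e n) = bot"
      using de(4)[of n] by (metis inf.commute inf_shunt)
    then have "inf (\<phi> w) (- b n) \<le> d n"
      by (simp add: b_def inf_sup_distrib1)
    then show ?thesis
      using a(2)[of n] by auto
  qed

  define x where "x m = Inf (\<phi> ` a ` {..m})" for m
  have "antimono x"
    unfolding x_def by (intro antimonoI Inf_superset_mono image_mono) auto
  moreover have "range x \<subseteq> U"
    using \<phi>(1) by (auto simp: x_def intro!: ultrafilter_Inf[OF U])
  ultimately obtain y where y: "y \<in> U" "\<And>m. \<exists>k. inf y (b k) \<le> x m"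
    using p b unfolding p_ultrafilter_def by blast
  then obtain g where g: "\<And>m. inf y (b (g m)) \<le> x m"
    by metis
  have x: "x m \<le> \<phi> (a m)" for m
    unfolding x_def by (rule Inf_lower) auto

  \<comment> \<open>\<open>nn\<close> outruns \<open>g\<close>, so that within
    \<open>b (nn (Suc j))\<close> the element \<open>y\<close> lies below
    \<open>x (nn j)\<close>.\<close>
  define nn where "nn = rec_nat 0 (\<lambda>_ k. Suc (max k (g k)))"
  have nn_Suc: "nn (Suc j) = Suc (max (nn j) (g (nn j)))" for j
    by (simp add: nn_def)
  have nn: "strict_mono nn"
    by (simp add: strict_mono_Suc_iff nn_Suc less_Suc_eq_le)
  define r where "r j = inf (b (nn j)) (- b (nn (Suc j)))" for j
  have r_less: "r j \<le> - r i" if "i < j" for i j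
  proof -
    have "nn (Suc i) \<le> nn j"
      using nn that by (simp add: strict_mono_less_eq)
    then have "r j \<le> b (nn (Suc i))"
      using antimonoD[OF b(1)] by (auto simp: r_def intro: le_infI1)
    also have "\<dots> \<le> - r i"
      by (simp add: r_def)
    finally show ?thesis .
  qed
  have r_disj: "r j \<le> - r i" if "i \<noteq> j" for i j
    using r_less[of i j] r_less[of j i] that compl_le_swap1 by (metis nat_neq_iff)
  \<comment> \<open>\<open>p = 0\<close> joins the even layers, \<open>p = 1\<close> the odd
    ones.\<close>
  define R where "R p = (SUP j. r (2 * j + p))" for p
  have "R 1 \<le> - r (2 * i)" for i
    unfolding R_def by (intro SUP_least r_disj) presburger
  then have "r (2 * i) \<le> - R 1" for i
    using compl_le_swap1 by blast
  then have "R 0 \<le> - R 1"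
    unfolding R_def[of 0] by (intro SUP_least) simp
  then have "inf (R 0) (R 1) = bot"
    by (simp add: inf_shunt)
  then have "R 0 \<notin> U \<or> R 1 \<notin> U"
    using U U_inf by (metis ultrafilter_def)
  then obtain p where p: "- R p \<in> U"
    using U by (metis ultrafilter_def)
  define u where "u = inf (inf (\<phi> w) y) (- R p)"
  have "u \<in> U"
    unfolding u_def using y(1) p \<phi>(1) by (intro U_inf) auto
  have "u \<le> \<phi> (a (nn (2 * j + p)))" for j
  proof -
    let ?m = "nn (2 * j + p)" and ?m' = "nn (Suc (2 * j + p))"
    have "r (2 * j + p) \<le> R p"
      unfolding R_def by (rule SUP_upper) simp
    then have "u \<le> - r (2 * j + p)"
      unfolding u_def by (meson compl_mono le_infI2)
    \<comment> \<open>Off the layer, \<open>u\<close> splits into a part outside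
      \<open>b ?m\<close>, where \<open>\<phi> w\<close> gives the bound, and a part inside
      \<open>b ?m'\<close>, where \<open>y\<close> does.\<close>
    then have "u = inf u (sup (- b ?m) (b ?m'))"
      by (simp add: r_def inf.absorb1)
    also have "\<dots> \<le> sup (inf (\<phi> w) (- b ?m)) (inf y (b ?m'))"
      unfolding inf_sup_distrib1 u_def by (intro sup_mono inf_mono order_refl) (auto intro: le_infI1)
    also have "\<dots> \<le> \<phi> (a ?m)"
    proof (rule le_supI[OF agree])
      have "b ?m' \<le> b (g ?m)"
        using antimonoD[OF b(1)] by (simp add: nn_Suc)
      then have "inf y (b ?m') \<le> inf y (b (g ?m))"
        by (rule inf_mono[OF order_refl])
      also have "\<dots> \<le> \<phi> (a ?m)"
        using g x order_trans by blast
      finally show "inf y (b ?m') \<le> \<phi> (a ?m)" .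
    qed
    finally show ?thesis .
  qed
  then have "range (\<lambda>j. a (nn (2 * j + p))) \<subseteq> {i. u \<le> \<phi> i}"
    by auto
  moreover have "inj (\<lambda>j. a (nn (2 * j + p)))"
    by (auto intro!: injI dest!: injD[OF a(1)] simp: strict_mono_eq[OF nn])
  ultimately show False
    using \<phi>(2)[OF \<open>u \<in> U\<close>] finite_subset range_inj_infinite by blast
qed

theorem corollary4p7:
  assumes "dominating_number =o continuum"
    and "ccc TYPE('a::{boolean_algebra, complete_lattice})"
    and "|UNIV :: 'a set| =o continuum"
    and "\<exists>D :: 'a set. dense_subalgebra D \<and> |D| <o continuum"
  shows "\<exists>U :: 'a set. ultrafilter U \<and> \<not> principal_filter U \<and> \<not> tukey_maximal U"
proof -
  obtain D :: "'a set" where D: "dense_subalgebra D" "|D| <o continuum"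
    using assms(4) by blast
  have inf: "infinite (UNIV :: 'a set)"
    using assms(3) infinite_nat_bool card_of_ordIso_finite unfolding continuum_eq by blast
  have "|uminus ` (atoms :: 'a set)| \<le>o |atoms :: 'a set|"
    by (rule card_of_image)
  also have "|atoms :: 'a set| \<le>o |D|"
    using atoms_subset_dense_subalgebra[OF D(1)] by (rule card_of_mono1)
  also note D(2)
  finally obtain U :: "'a set" where U: "p_ultrafilter U" "uminus ` atoms \<subseteq> U"
    using ex_p_ultrafilter[OF _ _ _ fip_uminus_atoms[OF inf]] assms(1,3) ordIso_imp_ordLeq
    unfolding continuum_eq by blast
  have "ultrafilter U"
    using U(1) by (simp add: p_ultrafilter_def)
  moreover have "\<not> principal_filter U"
    using calculation U(2) by (rule not_principal_filterI)
  moreover have "|D| <o |UNIV :: 'a set|"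
    using D(2) assms(3) ordIso_symmetric ordLess_ordIso_trans by blast
  then have "\<not> tukey_maximal U"
    using U(1) assms(2) D(1) infinite_dense_subalgebra[OF D(1) inf]
    by (intro p_ultrafilter_not_tukey_maximal)
  ultimately show ?thesis
    by blast
qed

end
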